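(* Let $1<s_0<s_1$ and let $u$ be a real-valued function of class $C^2$ defined in $\mathcal{K}_{[s_0,s_1]}$ which vanishes near the conical boundary $\{(t,x): t=r+1\}$. Then for all $s\in[s_0,s_1]$, $$E_{\mathrm{con}}(s,u)^{1/2}\le E_{\mathrm{con}}(s_0,u)^{1/2}+2\int_{s_0}^{s}\tau\,\|\Box u\|_{L^2(\mathcal{H}_\tau)}\,d\tau .$$
   Context: Coordinates on $\mathbb{R}^{1+3}$ are $(t,x)=(x^0,x^1,x^2,x^3)$, $r=|x|$, $\partial_0=\partial_t$, $\partial_a=\partial_{x^a}$ for $a=1,2,3$; repeated Latin indices are summed over $1,2,3$. $\Box=\partial_t^2-\sum_{a=1}^3\partial_a^2$. $\mathcal{K}=\{(t,x): t>|x|+1\}$; in $\mathcal K$ put $s=\sqrt{t^2-r^2}$. $\mathcal{H}_s=\{(t,x): t=\sqrt{s^2+|x|^2}\}$ and $\mathcal{K}_{[s_0,s_1]}=\{(t,x)\in\mathcal{K}: s_0\le \sqrt{t^2-r^2}\le s_1\}$. For a function $f$, $\int_{\mathcal{H}_s}f\,dx:=\int_{\mathbb{R}^3}f(\sqrt{s^2+|x|^2},x)\,dx$, and $\|f\|_{L^p(\mathcal{H}_s)}$ is the corresponding $L^p$ norm; functions defined in $\mathcal K$ and vanishing near the conical boundary (i.e. on the part of a neighbourhood of $\{t=r+1\}$ lying in their domain) are extended by zero outside $\mathcal{K}$. Hyperbolic frame: $\bar\partial_s=\bar\partial_0=\frac{s}{t}\partial_t$, $\bar\partial_a=\frac{x^a}{t}\partial_t+\partial_a$.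 $Ku:=s\bar\partial_su+2x^a\bar\partial_au$. The conformal (flat) energy is $$E_{\mathrm{con}}(s,u)=\int_{\mathcal{H}_s}\Big(\sum_{a=1}^3(s\bar\partial_au)^2+(Ku+2u)^2\Big)dx .$$ *)

theory Defs
  imports "HOL-Analysis.Analysis"
begin

type_synonym spacetime = "real \<times> (real^3)"

definition light_cone :: "spacetime set" where
  "light_cone = {(t, x). t > norm x + 1}"

definition cone_boundary :: "spacetime set" where
  "cone_boundary = {(t, x). t = norm x + 1}"

definition hyp_time :: "spacetime \<Rightarrow> real" where
  "hyp_time p = sqrt ((fst p)\<^sup>2 - (norm (snd p))\<^sup>2)"

definition slab :: "real \<Rightarrow> real \<Rightarrow> spacetime set" where
  "slab s\<^sub>0 s\<^sub>1 = {p \<in> light_cone. s\<^sub>0 \<le> hyp_time p \<and> hyp_time p \<le> s\<^sub>1}"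

definition hyp_point :: "real \<Rightarrow> real^3 \<Rightarrow> spacetime" where
  "hyp_point s x = (sqrt (s\<^sup>2 + (norm x)\<^sup>2), x)"

text \<open>
  All derivatives are taken within the domain \<open>D\<close> of the function, so that they depend only on its
  values on \<open>D\<close>; on the two hyperboloids bounding a slab they are the one-sided derivatives.
  If \<open>s\<^sub>0 < s\<^sub>1\<close>, every point of \<open>slab s\<^sub>0 s\<^sub>1\<close> is the vertex of a solid cone of directions pointing
  into the slab, hence derivatives within \<open>slab s\<^sub>0 s\<^sub>1\<close> are unique and the choice hidden in
  \<^const>\<open>frechet_derivative\<close> is harmless. On sets without this property the definitions
  below are not meaningful.
\<close>

definition pderiv_in :: "spacetime set \<Rightarrow> spacetime \<Rightarrow> (spacetime \<Rightarrow> real) \<Rightarrow> spacetime \<Rightarrow> real" where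
  "pderiv_in D e f p = frechet_derivative f (at p within D) e"

primrec Ck_on :: "nat \<Rightarrow> spacetime set \<Rightarrow> (spacetime \<Rightarrow> real) \<Rightarrow> bool" where
  "Ck_on 0 D f \<longleftrightarrow> continuous_on D f"
| "Ck_on (Suc k) D f \<longleftrightarrow> f differentiable_on D \<and> (\<forall>e\<in>Basis. Ck_on k D (pderiv_in D e f))"

definition vanishes_near_cone :: "spacetime set \<Rightarrow> (spacetime \<Rightarrow> real) \<Rightarrow> bool" where
  "vanishes_near_cone D f \<longleftrightarrow>
     (\<exists>N. open N \<and> cone_boundary \<subseteq> N \<and> (\<forall>p \<in> N \<inter> D. f p = 0))"

definition d_t :: "spacetime set \<Rightarrow> (spacetime \<Rightarrow> real) \<Rightarrow> spacetime \<Rightarrow> real" where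
  "d_t D = pderiv_in D (1, 0)"

definition d_x :: "spacetime set \<Rightarrow> 3 \<Rightarrow> (spacetime \<Rightarrow> real) \<Rightarrow> spacetime \<Rightarrow> real" where
  "d_x D a = pderiv_in D (0, axis a 1)"

definition wave_op :: "spacetime set \<Rightarrow> (spacetime \<Rightarrow> real) \<Rightarrow> spacetime \<Rightarrow> real" where
  "wave_op D u p = d_t D (d_t D u) p - (\<Sum>a\<in>UNIV. d_x D a (d_x D a u) p)"

definition bar_d_s :: "spacetime set \<Rightarrow> (spacetime \<Rightarrow> real) \<Rightarrow> spacetime \<Rightarrow> real" where
  "bar_d_s D u p = hyp_time p / fst p * d_t D u p"

definition bar_d_x :: "spacetime set \<Rightarrow> 3 \<Rightarrow> (spacetime \<Rightarrow> real) \<Rightarrow> spacetime \<Rightarrow> real" where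
  "bar_d_x D a u p = snd p $ a / fst p * d_t D u p + d_x D a u p"

definition K_op :: "spacetime set \<Rightarrow> (spacetime \<Rightarrow> real) \<Rightarrow> spacetime \<Rightarrow> real" where
  "K_op D u p = hyp_time p * bar_d_s D u p + 2 * (\<Sum>a\<in>UNIV. snd p $ a * bar_d_x D a u p)"

text \<open>
  Functions are extended by zero outside the cone, so the integral over \<open>t = sqrt (s\<^sup>2 + |x|\<^sup>2)\<close>
  with respect to \<open>dx\<close> runs over those \<open>x\<close> for which the point above \<open>x\<close> lies in the cone.
\<close>

definition hyp_integral :: "real \<Rightarrow> (spacetime \<Rightarrow> real) \<Rightarrow> real" where
  "hyp_integral s f = (LBINT x:{x. hyp_point s x \<in> light_cone}. f (hyp_point s x))"

definition hyp_L2_norm :: "real \<Rightarrow> (spacetime \<Rightarrow> real) \<Rightarrow> real" where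
  "hyp_L2_norm s f = sqrt (hyp_integral s (\<lambda>p. \<bar>f p\<bar>\<^sup>2))"

definition E_con :: "spacetime set \<Rightarrow> real \<Rightarrow> (spacetime \<Rightarrow> real) \<Rightarrow> real" where
  "E_con D s u =
     hyp_integral s (\<lambda>p. (\<Sum>a\<in>UNIV. (s * bar_d_x D a u p)\<^sup>2) + (K_op D u p + 2 * u p)\<^sup>2)"

end

theory Submission
  imports Defs
begin

text \<open>
  In the coordinates \<open>(s, x)\<close> the hyperbolic frame consists of the partial derivatives of
  \<open>V s x = u (sqrt (s\<^sup>2 + |x|\<^sup>2), x)\<close>, and \<open>s \<box>u = s V\<^sub>s\<^sub>s + 2 x\<cdot>\<nabla>V\<^sub>s + 3 V\<^sub>s - s \<Delta>V\<close>. Hence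
  \<open>W = s V\<^sub>s + 2 x\<cdot>\<nabla>V + 2 V\<close> satisfies \<open>W\<^sub>s = s (\<box>u + \<Delta>V)\<close>, and the energy density obeys
  \<open>\<partial>\<^sub>s (s\<^sup>2 |\<nabla>V|\<^sup>2 + W\<^sup>2) = 2 s W \<box>u + 2 s div (W \<nabla>V - |\<nabla>V|\<^sup>2 x)\<close>.
  The extension of \<open>u\<close> by zero has compact support in \<open>x\<close>, so the divergence integrates to zero and
  Cauchy-Schwarz gives \<open>E' \<le> 2 s sqrt E \<parallel>\<box>u\<parallel>\<close>. Thus the estimate holds even with constant \<open>1\<close> in place
  of \<open>2\<close>.
\<close>

section \<open>Integrals of compactly supported functions\<close>

text \<open>Integrals over the whole space become integrals over a box, to which the continuity and
  Leibniz theorems for parameter integrals apply.\<close>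

lemma continuous_compact_support_integral:
  fixes f :: "'a::euclidean_space \<Rightarrow> real"
  assumes "continuous_on UNIV f" and "\<And>x. x \<notin> cbox a b \<Longrightarrow> f x = 0"
  shows "integrable lborel f" and "integral\<^sup>L lborel f = integral (cbox a b) f"
proof -
  have *: "(\<lambda>x. indicator (cbox a b) x *\<^sub>R f x) = f"
    using assms(2) by (auto simp: fun_eq_iff indicator_def)
  have si: "set_integrable lborel (cbox a b) f"
    unfolding set_integrable_def
    by (rule borel_integrable_compact) (auto intro: continuous_on_subset[OF assms(1)])
  then show "integrable lborel f"
    by (simp add: set_integrable_def * del: real_scaleR_def)
  show "integral\<^sup>L lborel f = integral (cbox a b) f"
    using set_borel_integral_eq_integral(2)[OF si]
    by (simp add: set_lebesgue_integral_def * del: real_scaleR_def)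
qed

text \<open>Joint continuity and one set \<open>C\<close> serving all parameters are what passing
  limits and derivatives under the integral requires; \<open>C\<close> is later a box.\<close>

definition cont_supp :: "real set \<Rightarrow> 'a::euclidean_space set \<Rightarrow> (real \<Rightarrow> 'a \<Rightarrow> real) \<Rightarrow> bool" where
  "cont_supp I C f \<longleftrightarrow> continuous_on (I \<times> UNIV) (\<lambda>(s, x). f s x) \<and> (\<forall>s\<in>I. \<forall>x. x \<notin> C \<longrightarrow> f s x = 0)"

lemma cont_supp_slice: "cont_supp I C f \<Longrightarrow> s \<in> I \<Longrightarrow> continuous_on UNIV (f s)"
  unfolding cont_supp_def
  by (rule continuous_on_compose2[where f="\<lambda>x. (s, x)" and g="\<lambda>(s, x). f s x", simplified])
    (auto intro!: continuous_intros)

lemma cont_supp_subset: "cont_supp I C f \<Longrightarrow> J \<subseteq> I \<Longrightarrow> cont_supp J C f"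
  unfolding cont_supp_def by (auto intro: continuous_on_subset)

lemma cont_supp_add: "cont_supp I C f \<Longrightarrow> cont_supp I C g \<Longrightarrow> cont_supp I C (\<lambda>s x. f s x + g s x)"
  unfolding cont_supp_def by (auto simp: case_prod_unfold intro!: continuous_intros)

lemma cont_supp_diff: "cont_supp I C f \<Longrightarrow> cont_supp I C g \<Longrightarrow> cont_supp I C (\<lambda>s x. f s x - g s x)"
  unfolding cont_supp_def by (auto simp: case_prod_unfold intro!: continuous_intros)

lemma cont_supp_sum:
  "(\<And>i. i \<in> A \<Longrightarrow> cont_supp I C (f i)) \<Longrightarrow> cont_supp I C (\<lambda>s x. \<Sum>i\<in>A. f i s x)"
  unfolding cont_supp_def by (auto simp: case_prod_unfold intro!: continuous_intros)

lemma cont_supp_mult_left: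
  "continuous_on (I \<times> UNIV) (\<lambda>(s, x). c s x) \<Longrightarrow> cont_supp I C f \<Longrightarrow> cont_supp I C (\<lambda>s x. c s x * f s x)"
  unfolding cont_supp_def by (auto simp: case_prod_unfold intro!: continuous_intros)

lemma cont_supp_mult: "cont_supp I C f \<Longrightarrow> cont_supp I C g \<Longrightarrow> cont_supp I C (\<lambda>s x. f s x * g s x)"
  using cont_supp_mult_left[of I f C g] unfolding cont_supp_def by auto

lemma cont_supp_power2: "cont_supp I C f \<Longrightarrow> cont_supp I C (\<lambda>s x. (f s x)\<^sup>2)"
  unfolding power2_eq_square by (rule cont_supp_mult)

lemma cont_supp_integral:
  assumes "cont_supp I (cbox a b) f" "s \<in> I"
  shows "integrable lborel (f s)" "integral\<^sup>L lborel (f s) = integral (cbox a b) (f s)"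
  using continuous_compact_support_integral[OF cont_supp_slice[OF assms], of a b] assms
  by (auto simp: cont_supp_def)

lemma continuous_on_integral_cont_supp:
  assumes "cont_supp I (cbox a b) f"
  shows "continuous_on I (\<lambda>s. integral\<^sup>L lborel (f s))"
proof -
  have "continuous_on I (\<lambda>s. integral (cbox a b) (f s))"
    using assms by (intro integral_continuous_on_param) (auto simp: cont_supp_def intro: continuous_on_subset)
  then show ?thesis
    by (rule continuous_on_eq) (simp add: cont_supp_integral[OF assms])
qed

text \<open>On the fixed box the Leibniz rule applies because the pointwise derivative is jointly
  continuous. The parameter interval is open, so the derivative within it is two-sided.\<close>

lemma DERIV_integral_cont_supp:
  assumes f: "cont_supp {\<alpha><..<\<beta>} (cbox a b) f" and f': "cont_supp {\<alpha><..<\<beta>} (cbox a b) f'"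
    and der: "\<And>s x. s \<in> {\<alpha><..<\<beta>} \<Longrightarrow> ((\<lambda>\<sigma>. f \<sigma> x) has_real_derivative f' s x) (at s)"
    and s: "s \<in> {\<alpha><..<\<beta>}"
  shows "((\<lambda>s. integral\<^sup>L lborel (f s)) has_real_derivative integral\<^sup>L lborel (f' s)) (at s)"
proof -
  have "((\<lambda>s. integral (cbox a b) (f s)) has_real_derivative integral (cbox a b) (f' s))
      (at s within {\<alpha><..<\<beta>})"
  proof (rule leibniz_rule_field_derivative)
    show "f \<sigma> integrable_on cbox a b" if "\<sigma> \<in> {\<alpha><..<\<beta>}" for \<sigma>
      by (rule integrable_continuous) (rule continuous_on_subset[OF cont_supp_slice[OF f that]], simp)
  qed (use f' der s in \<open>auto simp: cont_supp_def intro: continuous_on_subset has_field_derivative_at_within\<close>)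
  then have "((\<lambda>s. integral\<^sup>L lborel (f s)) has_real_derivative integral (cbox a b) (f' s))
      (at s within {\<alpha><..<\<beta>})"
    by (rule has_field_derivative_transform_within[OF _ zero_less_one s])
      (simp add: cont_supp_integral[OF f])
  then show ?thesis
    using s by (simp add: at_within_open[OF s] cont_supp_integral[OF f' s])
qed

text \<open>
  By translation invariance \<open>h \<mapsto> \<integral> f (x + h e) dx\<close> is constant; differentiating under the integral
  sign at \<open>h = 0\<close> avoids Fubini and boundary terms.
\<close>

lemma integral_directional_derivative_eq_0:
  fixes f f' :: "'a::euclidean_space \<Rightarrow> real"
  assumes "continuous_on UNIV f" and "continuous_on UNIV f'"
    and "\<And>x. x \<notin> cbox a b \<Longrightarrow> f x = 0" and "\<And>x. x \<notin> cbox a b \<Longrightarrow> f' x = 0"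
    and der: "\<And>x. ((\<lambda>h. f (x + h *\<^sub>R e)) has_real_derivative f' x) (at 0)"
  shows "integral\<^sup>L lborel f' = 0"
proof -
  \<comment> \<open>The translates of the support by h in [-1, 1] form the continuous image of a
    compact set, hence lie in one box. It is the common support that \<open>cont_supp\<close>
    demands for h near 0.\<close>
  have "bounded (\<Union>h\<in>{-1..1}. (\<lambda>x. x - h *\<^sub>R e) ` cbox a b)"
  proof -
    have "(\<Union>h\<in>{-1..1::real}. (\<lambda>x. x - h *\<^sub>R e) ` cbox a b)
        = (\<lambda>(h, x). x - h *\<^sub>R e) ` ({-1..1} \<times> cbox a b)"
      by auto
    moreover have "compact \<dots>"
      by (intro compact_continuous_image compact_Times)
        (auto simp: case_prod_unfold intro!: continuous_intros)
    ultimately show ?thesis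
      by (simp add: compact_imp_bounded)
  qed
  then obtain c where c: "(\<Union>h\<in>{-1..1}. (\<lambda>x. x - h *\<^sub>R e) ` cbox a b) \<subseteq> cbox (-c) c"
    using bounded_subset_cbox_symmetric by blast
  have out: "x + h *\<^sub>R e \<notin> cbox a b" if "x \<notin> cbox (-c) c" "h \<in> {-1<..<1}" for x h
  proof
    assume "x + h *\<^sub>R e \<in> cbox a b"
    then have "x \<in> (\<Union>h\<in>{-1..1}. (\<lambda>x. x - h *\<^sub>R e) ` cbox a b)"
      using that(2) by (intro UN_I[of h]) (auto intro!: image_eqI[of _ _ "x + h *\<^sub>R e"])
    then show False using c that(1) by auto
  qed
  have supp: "cont_supp {-1<..<1} (cbox (-c) c) (\<lambda>h x. g (x + h *\<^sub>R e))"
    if "continuous_on UNIV g" "\<And>x. x \<notin> cbox a b \<Longrightarrow> g x = 0" for g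
    unfolding cont_supp_def
    using that out by (auto simp: case_prod_unfold intro!: continuous_on_compose2[OF that(1)] continuous_intros)
  have "((\<lambda>h. \<integral>x. f (x + h *\<^sub>R e) \<partial>lborel) has_real_derivative (\<integral>x. f' (x + 0 *\<^sub>R e) \<partial>lborel)) (at 0)"
  proof (rule DERIV_integral_cont_supp[OF supp supp])
    fix s x
    \<comment> \<open>The hypothesis \<open>der\<close> concerns h = 0 only; applied at the base
      point x + s e and shifted, it gives the derivative at every s.\<close>
    have "((\<lambda>h. f ((x + s *\<^sub>R e) + h *\<^sub>R e)) has_real_derivative f' (x + s *\<^sub>R e)) (at (s + - s))"
      using der by simp
    then have "((\<lambda>h. f ((x + s *\<^sub>R e) + (h + - s) *\<^sub>R e)) has_real_derivative f' (x + s *\<^sub>R e)) (at s)"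
      by (subst (asm) DERIV_shift)
    then show "((\<lambda>h. f (x + h *\<^sub>R e)) has_real_derivative f' (x + s *\<^sub>R e)) (at s)"
      by (simp add: algebra_simps)
  qed (use assms in auto)
  moreover have "(\<integral>x. f (x + h *\<^sub>R e) \<partial>lborel) = integral\<^sup>L lborel f" for h
  proof -
    have [measurable]: "f \<in> borel_measurable borel"
      by (rule borel_measurable_continuous_onI[OF assms(1)])
    have "integral\<^sup>L lborel f = integral\<^sup>L (distr lborel borel ((+) (h *\<^sub>R e))) f"
      by (simp only: lborel_distr_plus)
    also have "\<dots> = (\<integral>x. f (x + h *\<^sub>R e) \<partial>lborel)"
      by (subst integral_distr) (auto simp: add.commute)
    finally show ?thesis by simp
  qed
  ultimately have "((\<lambda>h. integral\<^sup>L lborel f) has_real_derivative integral\<^sup>L lborel f') (at 0)"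
    by simp
  then show ?thesis
    using DERIV_const DERIV_unique by blast
qed

section \<open>Inequalities and mixed partial derivatives\<close>

text \<open>Cauchy-Schwarz from the quadratic form in c and d given by the integral of (c f - d
  g)^2, which is nonnegative and can be expanded termwise.\<close>

lemma integral_mult_le_sqrt:
  fixes f g :: "'a \<Rightarrow> real"
  assumes f: "integrable M (\<lambda>x. (f x)\<^sup>2)" and g: "integrable M (\<lambda>x. (g x)\<^sup>2)"
    and fg: "integrable M (\<lambda>x. f x * g x)"
  shows "(\<integral>x. f x * g x \<partial>M) \<le> sqrt (\<integral>x. (f x)\<^sup>2 \<partial>M) * sqrt (\<integral>x. (g x)\<^sup>2 \<partial>M)"
proof -
  define F G H where "F = (\<integral>x. (f x)\<^sup>2 \<partial>M)" "G = (\<integral>x. (g x)\<^sup>2 \<partial>M)" "H = (\<integral>x. f x * g x \<partial>M)"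
  have quad: "0 \<le> c\<^sup>2 * F - 2 * (c * d) * H + d\<^sup>2 * G" for c d
  proof -
    have "0 \<le> (\<integral>x. (c * f x - d * g x)\<^sup>2 \<partial>M)" by simp
    also have "\<dots> = (\<integral>x. c\<^sup>2 * (f x)\<^sup>2 - 2 * (c * d) * (f x * g x) + d\<^sup>2 * (g x)\<^sup>2 \<partial>M)"
      by (rule Bochner_Integration.integral_cong) (auto simp: power2_eq_square algebra_simps)
    also have "\<dots> = c\<^sup>2 * F - 2 * (c * d) * H + d\<^sup>2 * G"
      using f g fg by (simp add: F_G_H_def)
    finally show ?thesis .
  qed
  have F: "F \<ge> 0" and G: "G \<ge> 0" by (auto simp: F_G_H_def)
  have "H\<^sup>2 \<le> F * G"
  proof (cases "F = 0")
    case True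
    have "H = 0"
    proof (rule ccontr)
      \<comment> \<open>With F = 0 the form is linear in c; at c = (G + 1) / H, d = 1 it equals G -
        2 (G + 1), which is negative.\<close>
      assume "H \<noteq> 0"
      then have "2 * ((G + 1) / H * 1) * H = 2 * (G + 1)" by simp
      then show False using quad[of "(G + 1) / H" 1] True G by simp
    qed
    then show ?thesis using True by simp
  next
    case False
    \<comment> \<open>The choice c = H, d = F turns the form into this product, and F > 0
      cancels.\<close>
    have "0 \<le> F * (F * G - H\<^sup>2)"
      using quad[of H F] by (simp add: power2_eq_square algebra_simps)
    then show ?thesis using False F by (auto simp: zero_le_mult_iff)
  qed
  then have "\<bar>H\<bar> \<le> sqrt (F * G)"
    by (rule real_le_rsqrt[of "\<bar>H\<bar>", simplified])
  then show ?thesis by (simp add: F_G_H_def real_sqrt_mult)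
qed

text \<open>Schwarz's theorem: applying the mean value theorem twice, in either order, writes the
  second difference over a square of side h as h^2 times either mixed derivative at some point of
  the square. Continuity at the origin then identifies the two values.\<close>

lemma mixed_partial_derivatives_eq:
  fixes f :: "real \<Rightarrow> real \<Rightarrow> real"
  assumes "\<delta> > 0"
    and f1: "\<And>x y. \<bar>x\<bar> < \<delta> \<Longrightarrow> \<bar>y\<bar> < \<delta> \<Longrightarrow> ((\<lambda>x. f x y) has_real_derivative f1 x y) (at x)"
    and f2: "\<And>x y. \<bar>x\<bar> < \<delta> \<Longrightarrow> \<bar>y\<bar> < \<delta> \<Longrightarrow> ((\<lambda>y. f x y) has_real_derivative f2 x y) (at y)"
    and f12: "\<And>x y. \<bar>x\<bar> < \<delta> \<Longrightarrow> \<bar>y\<bar> < \<delta> \<Longrightarrow> ((\<lambda>y. f1 x y) has_real_derivative f12 x y) (at y)"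
    and f21: "\<And>x y. \<bar>x\<bar> < \<delta> \<Longrightarrow> \<bar>y\<bar> < \<delta> \<Longrightarrow> ((\<lambda>x. f2 x y) has_real_derivative f21 x y) (at x)"
    and c12: "isCont (\<lambda>(x, y). f12 x y) (0, 0)" and c21: "isCont (\<lambda>(x, y). f21 x y) (0, 0)"
  shows "f12 0 0 = f21 0 0"
proof -
  have mvt: "\<exists>\<xi>\<in>{0<..<h}. \<exists>\<eta>\<in>{0<..<h}. g h h - g h 0 - g 0 h + g 0 0 = h\<^sup>2 * g12 \<xi> \<eta>"
    if h: "0 < h" "h < \<delta>"
      and g1: "\<And>x y. \<bar>x\<bar> < \<delta> \<Longrightarrow> \<bar>y\<bar> < \<delta> \<Longrightarrow> ((\<lambda>x. g x y) has_real_derivative g1 x y) (at x)"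
      and g12: "\<And>x y. \<bar>x\<bar> < \<delta> \<Longrightarrow> \<bar>y\<bar> < \<delta> \<Longrightarrow> ((\<lambda>y. g1 x y) has_real_derivative g12 x y) (at y)"
    for h and g g1 g12 :: "real \<Rightarrow> real \<Rightarrow> real"
  proof -
    have "\<exists>z>0. z < h \<and> (g h h - g h 0) - (g 0 h - g 0 0) = (h - 0) * (g1 z h - g1 z 0)"
      using h by (intro MVT2 DERIV_diff g1) auto
    then obtain z where z: "0 < z" "z < h"
      "(g h h - g h 0) - (g 0 h - g 0 0) = h * (g1 z h - g1 z 0)" by auto
    have "\<exists>w>0. w < h \<and> g1 z h - g1 z 0 = (h - 0) * g12 z w"
      using h z by (intro MVT2 g12) auto
    then obtain w where "0 < w" "w < h" "g1 z h - g1 z 0 = h * g12 z w" by auto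
    with z show ?thesis
      by (intro bexI[of _ z] bexI[of _ w]) (auto simp: power2_eq_square)
  qed
  have "\<bar>f12 0 0 - f21 0 0\<bar> \<le> \<epsilon>" if "\<epsilon> > 0" for \<epsilon>
  proof -
    have "\<epsilon> / 2 > 0" using that by simp
    then obtain d1 where d1: "d1 > 0" "\<And>z. dist z (0, 0) < d1 \<Longrightarrow> dist (f12 (fst z) (snd z)) (f12 0 0) < \<epsilon> / 2"
      using c12 unfolding continuous_at_eps_delta case_prod_unfold by fastforce
    obtain d2 where d2: "d2 > 0" "\<And>z. dist z (0, 0) < d2 \<Longrightarrow> dist (f21 (fst z) (snd z)) (f21 0 0) < \<epsilon> / 2"
      using c21 \<open>\<epsilon> / 2 > 0\<close> unfolding continuous_at_eps_delta case_prod_unfold by fastforce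
    \<comment> \<open>Halving makes \<open>2 * h\<close> at most \<open>d1\<close> and
      \<open>d2\<close>, and every point of the open square of side h lies closer than
      \<open>2 * h\<close> to the origin.\<close>
    define h where "h = min (min d1 d2) \<delta> / 2"
    have h: "0 < h" "h < \<delta>" "2 * h \<le> d1" "2 * h \<le> d2"
      using d1 d2 \<open>\<delta> > 0\<close> by (auto simp: h_def)
    obtain x y where xy: "0 < x" "x < h" "0 < y" "y < h"
      "f h h - f h 0 - f 0 h + f 0 0 = h\<^sup>2 * f12 x y"
      using mvt[OF h(1,2) f1 f12] by auto
    \<comment> \<open>The second difference is symmetric in its two directions, so
      \<open>mvt\<close> with exchanged arguments yields the other mixed derivative.\<close>
    obtain x' y' where xy': "0 < x'" "x' < h" "0 < y'" "y' < h"
      "f h h - f 0 h - f h 0 + f 0 0 = h\<^sup>2 * f21 x' y'"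
      using mvt[where g="\<lambda>y x. f x y" and ?g1.0="\<lambda>y x. f2 x y" and ?g12.0="\<lambda>y x. f21 x y", OF h(1,2) f2 f21]
      by auto
    have "h\<^sup>2 * f12 x y = h\<^sup>2 * f21 x' y'"
      using xy(5) xy'(5) by linarith
    then have eq: "f12 x y = f21 x' y'"
      using h(1) by simp
    have dist: "dist (p, q) (0, 0) < 2 * h" if "0 < p" "p < h" "0 < q" "q < h" for p q :: real
      using that norm_Pair_le[of p q] by (simp add: dist_norm)
    have "dist (f12 x y) (f12 0 0) < \<epsilon> / 2" "dist (f21 x' y') (f21 0 0) < \<epsilon> / 2"
      using d1(2)[of "(x, y)"] d2(2)[of "(x', y')"] dist[OF xy(1-4)] dist[OF xy'(1-4)] h by auto
    then show ?thesis
      using eq unfolding dist_real_def by linarith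
  qed
  then have "\<bar>f12 0 0 - f21 0 0\<bar> \<le> 0"
    by (rule field_le_epsilon[of _ 0, simplified])
  then show ?thesis by simp
qed

text \<open>\<open>E\<close> may vanish, so the proof differentiates \<open>sqrt (E + \<epsilon>)\<close> and lets \<open>\<epsilon>\<close> tend to \<open>0\<close>.\<close>

lemma sqrt_le_of_derivative_le:
  fixes E E' n :: "real \<Rightarrow> real"
  assumes "a \<le> b" and E: "continuous_on {a..b} E" and n: "continuous_on {a..b} n"
    and E0: "\<And>s. s \<in> {a..b} \<Longrightarrow> E s \<ge> 0"
    and E': "\<And>s. a < s \<Longrightarrow> s < b \<Longrightarrow> (E has_real_derivative E' s) (at s)"
    and le: "\<And>s. a < s \<Longrightarrow> s < b \<Longrightarrow> E' s \<le> 2 * sqrt (E s) * n s"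
    and n0: "\<And>s. s \<in> {a..b} \<Longrightarrow> n s \<ge> 0"
  shows "sqrt (E b) \<le> sqrt (E a) + integral {a..b} n"
proof (cases "a = b")
  case False
  with assms(1) have ab: "a < b" by simp
  have "sqrt (E b + \<epsilon>) \<le> sqrt (E a + \<epsilon>) + integral {a..b} n" if "\<epsilon> > 0" for \<epsilon>
  proof -
    \<comment> \<open>The root grows at most at rate \<open>n\<close>, so subtracting the integral
      of \<open>n\<close> leaves a nonincreasing function.\<close>
    define G where "G = (\<lambda>s. sqrt (E s + \<epsilon>) - integral {a..s} n)"
    have "continuous_on {a..b} G"
      unfolding G_def
      by (intro continuous_intros E indefinite_integral_continuous_1 integrable_continuous_real n)
    moreover have "\<exists>y. (G has_real_derivative y) (at s) \<and> y \<le> 0" if s: "a < s" "s < b" for s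
    proof -
      have pos: "E s + \<epsilon> > 0" using E0[of s] s \<open>\<epsilon> > 0\<close> by simp
      have "((\<lambda>s. integral {a..s} n) has_real_derivative n s) (at s within {a..b})"
        using s by (intro integral_has_real_derivative n) auto
      then have "((\<lambda>s. integral {a..s} n) has_real_derivative n s) (at s)"
        using s by (simp add: at_within_Icc_at)
      then have "(G has_real_derivative (inverse (sqrt (E s + \<epsilon>)) / 2 * E' s - n s)) (at s)"
        unfolding G_def using pos by (auto intro!: derivative_eq_intros E' s)
      moreover have "inverse (sqrt (E s + \<epsilon>)) / 2 * E' s - n s \<le> 0"
      proof -
        have "E' s \<le> 2 * sqrt (E s) * n s" using le s .
        also have "\<dots> \<le> 2 * sqrt (E s + \<epsilon>) * n s"
          using n0[of s] s \<open>\<epsilon> > 0\<close> by (intro mult_right_mono) auto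
        finally show ?thesis using pos by (simp add: field_simps)
      qed
      ultimately show ?thesis by blast
    qed
    ultimately have "G b \<le> G a"
      using ab by (intro DERIV_nonpos_imp_decreasing_open[of a b G]) auto
    then show ?thesis by (simp add: G_def)
  qed
  then have ev: "eventually (\<lambda>\<epsilon>. sqrt (E b + \<epsilon>) \<le> sqrt (E a + \<epsilon>) + integral {a..b} n) (at_right 0)"
    by (auto simp: eventually_at_right_less intro: eventually_mono[OF eventually_at_right_less])
  have "((\<lambda>\<epsilon>. sqrt (E b + \<epsilon>)) \<longlongrightarrow> sqrt (E b + 0)) (at_right 0)"
    "((\<lambda>\<epsilon>. sqrt (E a + \<epsilon>) + integral {a..b} n) \<longlongrightarrow> sqrt (E a + 0) + integral {a..b} n) (at_right 0)"
    by (intro tendsto_intros)+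
  then show ?thesis
    using tendsto_le[OF _ _ _ ev] by fastforce
qed simp

section \<open>The energy identity in hyperbolic coordinates\<close>

text \<open>
  \<open>Vx i\<close>, \<open>Vsx i\<close> and \<open>Vxx i j\<close> stand for \<open>\<partial>\<^sub>iV\<close>, \<open>\<partial>\<^sub>s\<partial>\<^sub>iV\<close> and \<open>\<partial>\<^sub>i\<partial>\<^sub>jV\<close>, and \<open>B\<close> for the wave operator
  applied to \<open>u\<close>.
\<close>

lemma conformal_energy_derivative:
  fixes \<alpha> \<beta> s :: real and lo hi :: "real^3" and V Vs Vss B :: "real \<Rightarrow> real^3 \<Rightarrow> real"
    and Vx Vsx :: "3 \<Rightarrow> real \<Rightarrow> real^3 \<Rightarrow> real"
    and Vxx :: "3 \<Rightarrow> 3 \<Rightarrow> real \<Rightarrow> real^3 \<Rightarrow> real"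
  defines "I \<equiv> {\<alpha><..<\<beta>}" and "C \<equiv> cbox lo hi"
  defines "W \<equiv> \<lambda>s x. s * Vs s x + 2 * (\<Sum>i\<in>UNIV. x $ i * Vx i s x) + 2 * V s x"
  assumes supp: "cont_supp I C V" "cont_supp I C Vs" "\<And>i. cont_supp I C (Vx i)" "cont_supp I C Vss"
      "\<And>i. cont_supp I C (Vsx i)" "\<And>i j. cont_supp I C (Vxx i j)" "cont_supp I C B"
    and ds: "\<And>s x. s \<in> I \<Longrightarrow> ((\<lambda>\<sigma>. V \<sigma> x) has_real_derivative Vs s x) (at s)"
      "\<And>s x. s \<in> I \<Longrightarrow> ((\<lambda>\<sigma>. Vs \<sigma> x) has_real_derivative Vss s x) (at s)"
      "\<And>s x i. s \<in> I \<Longrightarrow> ((\<lambda>\<sigma>. Vx i \<sigma> x) has_real_derivative Vsx i s x) (at s)"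
    and dx: "\<And>s x i. s \<in> I \<Longrightarrow> ((\<lambda>h. V s (x + h *\<^sub>R axis i 1)) has_real_derivative Vx i s x) (at 0)"
      "\<And>s x i. s \<in> I \<Longrightarrow> ((\<lambda>h. Vs s (x + h *\<^sub>R axis i 1)) has_real_derivative Vsx i s x) (at 0)"
      "\<And>s x i j. s \<in> I \<Longrightarrow> ((\<lambda>h. Vx j s (x + h *\<^sub>R axis i 1)) has_real_derivative Vxx i j s x) (at 0)"
    and sym: "\<And>s x i j. s \<in> I \<Longrightarrow> Vxx i j s x = Vxx j i s x"
    and wave: "\<And>s x. s \<in> I \<Longrightarrow> s * B s x = s * Vss s x + 2 * (\<Sum>i\<in>UNIV. x $ i * Vsx i s x) + 3 * Vs s x
      - s * (\<Sum>i\<in>UNIV. Vxx i i s x)"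
    and s: "s \<in> I"
  shows "((\<lambda>s. \<integral>x. (\<Sum>i\<in>UNIV. (s * Vx i s x)\<^sup>2) + (W s x)\<^sup>2 \<partial>lborel)
    has_real_derivative 2 * s * (\<integral>x. W s x * B s x \<partial>lborel)) (at s)"
proof -
  \<comment> \<open>Product rule: in \<open>Ws\<close> the 3 is 1 from the factor s and 2 from 2 V;
    in \<open>Wx\<close> the 4 is 2 from differentiating x^i and 2 from 2 V.\<close>
  define Ws where "Ws = (\<lambda>s x. s * Vss s x + 2 * (\<Sum>i\<in>UNIV. x $ i * Vsx i s x) + 3 * Vs s x)"
  define Wx where "Wx = (\<lambda>i s x. s * Vsx i s x + 4 * Vx i s x + 2 * (\<Sum>j\<in>UNIV. x $ j * Vxx i j s x))"
  define Q where "Q = (\<lambda>s x. \<Sum>j\<in>UNIV. (Vx j s x)\<^sup>2)"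
  define Qx where "Qx = (\<lambda>i s x. \<Sum>j\<in>UNIV. 2 * (Vx j s x * Vxx i j s x))"
  \<comment> \<open>\<open>F\<close> is the flux W grad V - |grad V|^2 x. \<open>Fx i\<close> is the
    i-th derivative of its i-th component, so the \<open>Fx i\<close> sum to the divergence, and
    each integrates to zero separately.\<close>
  define F where "F = (\<lambda>i s x. W s x * Vx i s x - x $ i * Q s x)"
  define Fx where "Fx = (\<lambda>i s x. Wx i s x * Vx i s x + W s x * Vxx i i s x - (Q s x + x $ i * Qx i s x))"
  define e where "e = (\<lambda>s x. (\<Sum>i\<in>UNIV. (s * Vx i s x)\<^sup>2) + (W s x)\<^sup>2)"
  define es where "es = (\<lambda>s x. (\<Sum>i\<in>UNIV. 2 * ((s * Vx i s x) * (Vx i s x + s * Vsx i s x))) + 2 * (W s x * Ws s x))"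
  note lin = cont_supp_add cont_supp_diff cont_supp_sum cont_supp_mult_left supp
  have W: "cont_supp I C W" and Ws: "cont_supp I C Ws" and Wx: "cont_supp I C (Wx i)" for i
    unfolding W_def Ws_def Wx_def
    by ((intro lin); auto simp: case_prod_unfold intro!: continuous_intros)+
  have sVx: "cont_supp I C (\<lambda>s x. s * Vx i s x)" "cont_supp I C (\<lambda>s x. Vx i s x + s * Vsx i s x)" for i
    by ((intro lin); auto simp: case_prod_unfold intro!: continuous_intros)+
  have Q: "cont_supp I C Q"
    unfolding Q_def by (intro cont_supp_sum cont_supp_power2 supp)
  have Qx: "cont_supp I C (Qx i)" for i
    unfolding Qx_def
    by (intro cont_supp_sum cont_supp_mult_left[OF _ cont_supp_mult] supp) (auto intro!: continuous_intros)
  have xQ: "cont_supp I C (\<lambda>s x. x $ i * Q s x)" "cont_supp I C (\<lambda>s x. x $ i * Qx i s x)" for i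
    by (intro cont_supp_mult_left Q Qx; auto simp: case_prod_unfold intro!: continuous_intros)+
  have F: "cont_supp I C (F i)" and Fx: "cont_supp I C (Fx i)" for i
    unfolding F_def Fx_def
    by (intro cont_supp_add cont_supp_diff cont_supp_mult W Wx Q xQ supp)+
  have e: "cont_supp I C e"
    unfolding e_def by (intro cont_supp_add cont_supp_sum cont_supp_power2 W sVx)
  have es: "cont_supp I C es"
    unfolding es_def
    by (intro cont_supp_add cont_supp_sum cont_supp_mult_left[OF _ cont_supp_mult] W Ws sVx)
      (auto intro!: continuous_intros)
  have "((\<lambda>s. integral\<^sup>L lborel (e s)) has_real_derivative integral\<^sup>L lborel (es s)) (at s)"
  proof (rule DERIV_integral_cont_supp[OF e[unfolded I_def C_def] es[unfolded I_def C_def] _ s[unfolded I_def]])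
    fix \<sigma> x assume "\<sigma> \<in> {\<alpha><..<\<beta>}"
    then have "\<sigma> \<in> I" by (simp add: I_def)
    note [derivative_intros] = ds[OF this]
    have dW: "((\<lambda>\<sigma>. W \<sigma> x) has_real_derivative Ws \<sigma> x) (at \<sigma>)"
      unfolding W_def Ws_def
      by (auto intro!: derivative_eq_intros DERIV_sum simp: algebra_simps)
    show "((\<lambda>\<sigma>. e \<sigma> x) has_real_derivative es \<sigma> x) (at \<sigma>)"
      unfolding e_def es_def
      by (auto intro!: derivative_eq_intros dW simp: power2_eq_square algebra_simps)
  qed
  moreover have "integral\<^sup>L lborel (es s) = 2 * s * (\<integral>x. W s x * B s x \<partial>lborel)"
  proof -
    have Fx0: "integral\<^sup>L lborel (Fx i s) = 0" for i
    proof (rule integral_directional_derivative_eq_0[OF cont_supp_slice[OF F s] cont_supp_slice[OF Fx s]])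
      fix x
      note d = dx[OF s, where i=i and x=x]
      note [derivative_intros] = d
      have nth: "((\<lambda>h. (x + h *\<^sub>R axis i 1) $ j) has_real_derivative axis i 1 $ j) (at 0)" for j
        by (auto intro!: derivative_eq_intros)
      have dW: "((\<lambda>h. W s (x + h *\<^sub>R axis i 1)) has_real_derivative Wx i s x) (at 0)"
      proof -
        have "(\<Sum>j\<in>UNIV. x $ j * Vxx i j s x + axis i 1 $ j * Vx j s x)
            = (\<Sum>j\<in>UNIV. x $ j * Vxx i j s x) + Vx i s x"
          by (simp add: sum.distrib axis_def if_distrib[of "\<lambda>c. c * _"] cong: if_cong)
        then show ?thesis
          unfolding W_def Wx_def
          by (auto intro!: derivative_eq_intros nth simp del: vector_add_component
              simp: algebra_simps)
      qed
      have dQ: "((\<lambda>h. Q s (x + h *\<^sub>R axis i 1)) has_real_derivative Qx i s x) (at 0)"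
        unfolding Q_def Qx_def by (auto intro!: derivative_eq_intros simp: mult.commute)
      show "((\<lambda>h. F i s (x + h *\<^sub>R axis i 1)) has_real_derivative Fx i s x) (at 0)"
        unfolding F_def Fx_def
        by (rule derivative_eq_intros dW dQ nth d refl)+ simp
    qed (use F Fx s in \<open>auto simp: cont_supp_def C_def\<close>)
    \<comment> \<open>The wave equation replaces 2 W W_s by 2 s W (B + \<Delta>V). In the divergence
      the Hessian terms carrying x cancel by symmetry, and of the 4 |grad V|^2 from
      \<open>Wx\<close> the divergence of x removes 3.\<close>
    have "es s x = 2 * s * (W s x * B s x) + (\<Sum>i\<in>UNIV. 2 * s * Fx i s x)" for x
    proof -
      have Ws_eq: "Ws s x = s * B s x + s * (\<Sum>i\<in>UNIV. Vxx i i s x)"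
        using wave[OF s, of x] by (simp add: Ws_def)
      have symm: "Vxx 2 1 s x = Vxx 1 2 s x" "Vxx 3 1 s x = Vxx 1 3 s x" "Vxx 3 2 s x = Vxx 2 3 s x"
        using sym[OF s] by auto
      show ?thesis
        unfolding es_def Fx_def Ws_eq Wx_def Q_def Qx_def
        by (simp add: sum_3 symm power2_eq_square algebra_simps)
    qed
    then have "integral\<^sup>L lborel (es s) =
        (\<integral>x. 2 * s * (W s x * B s x) + (\<Sum>i\<in>UNIV. 2 * s * Fx i s x) \<partial>lborel)"
      by (simp cong: Bochner_Integration.integral_cong)
    also have "\<dots> = 2 * s * (\<integral>x. W s x * B s x \<partial>lborel)"
      using cont_supp_integral(1)[OF Fx[unfolded C_def] s]
        cont_supp_integral(1)[OF cont_supp_mult[OF W supp(7), unfolded C_def] s] Fx0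
      by simp
    finally show ?thesis .
  qed
  ultimately show ?thesis by (simp add: e_def)
qed

section \<open>Functions on the slab in hyperbolic coordinates\<close>

text \<open>The extension by zero, pulled back to the coordinates (s, x), so that for each s the
  analysis takes place on all of R^3.\<close>

definition hyp_lift :: "(spacetime \<Rightarrow> real) \<Rightarrow> real \<Rightarrow> real^3 \<Rightarrow> real" where
  "hyp_lift f s x = (if hyp_point s x \<in> light_cone then f (hyp_point s x) else 0)"

text \<open>At its points derivatives within the slab are ordinary two-sided derivatives.\<close>

definition open_slab :: "real \<Rightarrow> real \<Rightarrow> spacetime set" where
  "open_slab s\<^sub>0 s\<^sub>1 = {p \<in> light_cone. s\<^sub>0 < hyp_time p \<and> hyp_time p < s\<^sub>1}"

lemma hyp_time_hyp_point: "s \<ge> 0 \<Longrightarrow> hyp_time (hyp_point s x) = s"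
  by (simp add: hyp_time_def hyp_point_def)

lemma hyp_point_hyp_time:
  assumes "p \<in> light_cone"
  shows "hyp_point (hyp_time p) (snd p) = p"
proof -
  obtain t x where p: "p = (t, x)" by (cases p)
  have t: "t > norm x + 1" using assms by (simp add: p light_cone_def)
  then have "(norm x)\<^sup>2 \<le> t\<^sup>2"
    by (intro power_mono) auto
  then show ?thesis
    using t order_le_less_trans[OF norm_ge_zero, of x "t - 1"] by (simp add: p hyp_time_def hyp_point_def)
qed

lemma open_light_cone: "open light_cone"
proof -
  have "light_cone = {p. norm (snd p) + 1 < fst p}"
    by (auto simp: light_cone_def)
  moreover have "open \<dots>"
    by (intro open_Collect_less continuous_intros)
  ultimately show ?thesis by simp
qed

lemma open_open_slab: "open (open_slab s\<^sub>0 s\<^sub>1)"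
proof -
  have "continuous_on UNIV hyp_time"
    unfolding hyp_time_def by (intro continuous_intros)
  then have "open (light_cone \<inter> {p. s\<^sub>0 < hyp_time p} \<inter> {p. hyp_time p < s\<^sub>1})"
    by (intro open_Int open_light_cone open_Collect_less continuous_intros)
  moreover have "light_cone \<inter> {p. s\<^sub>0 < hyp_time p} \<inter> {p. hyp_time p < s\<^sub>1} = open_slab s\<^sub>0 s\<^sub>1"
    by (auto simp: open_slab_def)
  ultimately show ?thesis by simp
qed

lemma open_slab_subset: "open_slab s\<^sub>0 s\<^sub>1 \<subseteq> slab s\<^sub>0 s\<^sub>1"
  by (auto simp: open_slab_def slab_def)

lemma at_within_slab: "p \<in> open_slab s\<^sub>0 s\<^sub>1 \<Longrightarrow> at p within slab s\<^sub>0 s\<^sub>1 = at p"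
  by (meson at_within_interior interior_maximal open_open_slab open_slab_subset subsetD)

lemma hyp_point_in_slab:
  "0 \<le> s\<^sub>0 \<Longrightarrow> s \<in> {s\<^sub>0..s\<^sub>1} \<Longrightarrow> hyp_point s x \<in> light_cone \<Longrightarrow> hyp_point s x \<in> slab s\<^sub>0 s\<^sub>1"
  by (auto simp: slab_def hyp_time_hyp_point)

lemma hyp_point_in_open_slab:
  "0 \<le> s\<^sub>0 \<Longrightarrow> s \<in> {s\<^sub>0<..<s\<^sub>1} \<Longrightarrow> hyp_point s x \<in> light_cone \<Longrightarrow> hyp_point s x \<in> open_slab s\<^sub>0 s\<^sub>1"
  by (auto simp: open_slab_def hyp_time_hyp_point)

lemma continuous_on_hyp_point [continuous_intros]:
  "continuous_on A f \<Longrightarrow> continuous_on A g \<Longrightarrow> continuous_on A (\<lambda>z. hyp_point (f z) (g z))"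
  unfolding hyp_point_def by (intro continuous_intros)

text \<open>Squaring |x| + 1 < sqrt (s^2 + |x|^2) leaves 2 |x| + 1 < s^2. This is why the extensions
  by zero have compact support in x.\<close>

lemma norm_le_of_hyp_point_in_light_cone:
  assumes "hyp_point s x \<in> light_cone"
  shows "norm x \<le> s\<^sup>2"
proof -
  have "norm x + 1 < sqrt (s\<^sup>2 + (norm x)\<^sup>2)"
    using assms by (simp add: hyp_point_def light_cone_def)
  then have "(norm x + 1)\<^sup>2 < (sqrt (s\<^sup>2 + (norm x)\<^sup>2))\<^sup>2"
    by (intro power_strict_mono) auto
  then have "2 * norm x + 1 < s\<^sup>2"
    by (simp add: power2_sum)
  then show ?thesis
    using norm_ge_zero[of x] by linarith
qed

text \<open>The complement of the cone consists of its boundary, covered by \<open>N\<close>, and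
  the open region t < |x| + 1, where lifts vanish by definition. One \<open>U\<close> serves every
  f.\<close>

lemma hyp_lift_eq_0_near_complement:
  assumes "open N" and "cone_boundary \<subseteq> N"
  obtains U where "open U" "- light_cone \<subseteq> U"
    "\<And>f s x. \<lbrakk>0 \<le> s\<^sub>0; s \<in> {s\<^sub>0..s\<^sub>1}; \<forall>p \<in> N \<inter> slab s\<^sub>0 s\<^sub>1. f p = 0; hyp_point s x \<in> U\<rbrakk> \<Longrightarrow> hyp_lift f s x = 0"
proof
  let ?U = "N \<union> {p. fst p < norm (snd p) + 1}"
  show "open ?U"
    by (intro open_Un assms open_Collect_less continuous_intros)
  show "- light_cone \<subseteq> ?U"
    using assms(2) by (force simp: light_cone_def cone_boundary_def)
  show "hyp_lift f s x = 0"
    if "0 \<le> s\<^sub>0" "s \<in> {s\<^sub>0..s\<^sub>1}" "\<forall>p \<in> N \<inter> slab s\<^sub>0 s\<^sub>1. f p = 0" "hyp_point s x \<in> ?U" for f s x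
    using that hyp_point_in_slab[OF that(1,2), of x]
    by (auto simp: hyp_lift_def light_cone_def)
qed

text \<open>The preimages of the cone and of the neighbourhood \<open>U\<close> of its complement
  are open and cover everything. On the first the lift is a composition of continuous maps, on the
  second it is zero.\<close>

lemma cont_supp_hyp_lift:
  assumes "0 \<le> s\<^sub>0" and f: "continuous_on (slab s\<^sub>0 s\<^sub>1) f"
    and N: "open N" "cone_boundary \<subseteq> N" and f0: "\<forall>p \<in> N \<inter> slab s\<^sub>0 s\<^sub>1. f p = 0"
    and C: "cball 0 (s\<^sub>1\<^sup>2) \<subseteq> C"
  shows "cont_supp {s\<^sub>0..s\<^sub>1} C (hyp_lift f)"
proof -
  let ?J = "{s\<^sub>0..s\<^sub>1} \<times> (UNIV :: (real^3) set)"
  let ?\<Psi> = "\<lambda>z. hyp_point (fst z) (snd z)"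
  let ?A = "?\<Psi> -` light_cone"
  obtain U where U: "open U" "- light_cone \<subseteq> U"
    and U0: "\<And>s x. s \<in> {s\<^sub>0..s\<^sub>1} \<Longrightarrow> hyp_point s x \<in> U \<Longrightarrow> hyp_lift f s x = 0"
    using hyp_lift_eq_0_near_complement[OF N, of s\<^sub>0 s\<^sub>1] assms(1) f0 by metis
  let ?B = "?\<Psi> -` U"
  have \<Psi>: "continuous_on UNIV ?\<Psi>" by (intro continuous_intros)
  have A: "open ?A" and B: "open ?B"
    using open_vimage[OF open_light_cone \<Psi>] open_vimage[OF U(1) \<Psi>] .
  have cA: "continuous_on (?J \<inter> ?A) (\<lambda>(s, x). hyp_lift f s x)"
  proof (rule continuous_on_eq)
    have "?\<Psi> ` (?J \<inter> ?A) \<subseteq> slab s\<^sub>0 s\<^sub>1"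
      by (intro image_subsetI hyp_point_in_slab assms(1)) auto
    then show "continuous_on (?J \<inter> ?A) (f \<circ> ?\<Psi>)"
      by (intro continuous_on_compose continuous_on_subset[OF \<Psi>] continuous_on_subset[OF f]) auto
  qed (auto simp: hyp_lift_def)
  have cB: "continuous_on (?J \<inter> ?B) (\<lambda>(s, x). hyp_lift f s x)"
    by (rule continuous_on_eq[OF continuous_on_const[of _ 0]]) (auto simp: U0)
  have "continuous (at z within ?J) (\<lambda>(s, x). hyp_lift f s x)" if z: "z \<in> ?J" for z
  proof (cases "z \<in> ?A")
    case True
    have "at z within ?J = at z within (?J \<inter> ?A)"
      by (rule at_within_nhd[OF True A]) auto
    then show ?thesis
      using cA z True by (simp only: continuous_on_eq_continuous_within) auto
  next
    case False
    then have zB: "z \<in> ?B" using U(2) by auto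
    have "at z within ?J = at z within (?J \<inter> ?B)"
      by (rule at_within_nhd[OF zB B]) auto
    then show ?thesis
      using cB z zB by (simp only: continuous_on_eq_continuous_within) auto
  qed
  moreover have "hyp_lift f s x = 0" if "s \<in> {s\<^sub>0..s\<^sub>1}" "x \<notin> C" for s x
  proof -
    have "s\<^sup>2 \<le> s\<^sub>1\<^sup>2" using that assms(1) by (intro power_mono) auto
    then show ?thesis
      using norm_le_of_hyp_point_in_light_cone[of s x] C that(2)
      by (force simp: hyp_lift_def)
  qed
  ultimately show ?thesis
    by (auto simp: cont_supp_def continuous_on_eq_continuous_within)
qed

section \<open>Derivatives within the slab and of lifted functions\<close>

lemma has_derivative_in_open_slab:
  assumes f: "f differentiable_on slab s\<^sub>0 s\<^sub>1" and p: "p \<in> open_slab s\<^sub>0 s\<^sub>1"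
  shows "(f has_derivative (\<lambda>v. pderiv_in (slab s\<^sub>0 s\<^sub>1) v f p)) (at p)"
proof -
  have "f differentiable (at p within slab s\<^sub>0 s\<^sub>1)"
    using f p open_slab_subset by (auto simp: differentiable_on_def)
  then show ?thesis
    using at_within_slab[OF p] by (simp add: frechet_derivative_works pderiv_in_def)
qed

lemma pderiv_in_eq_d_t_d_x:
  assumes f: "f differentiable_on slab s\<^sub>0 s\<^sub>1" and p: "p \<in> open_slab s\<^sub>0 s\<^sub>1"
  shows "pderiv_in (slab s\<^sub>0 s\<^sub>1) (a, y) f p
    = a * d_t (slab s\<^sub>0 s\<^sub>1) f p + (\<Sum>i\<in>UNIV. y $ i * d_x (slab s\<^sub>0 s\<^sub>1) i f p)"
proof -
  interpret bounded_linear "\<lambda>v. pderiv_in (slab s\<^sub>0 s\<^sub>1) v f p"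
    by (rule has_derivative_bounded_linear[OF has_derivative_in_open_slab[OF assms]])
  have "(a, y) = a *\<^sub>R (1, 0) + (\<Sum>i\<in>UNIV. y $ i *\<^sub>R (0, axis i 1))"
    using basis_expansion[of y]
    by (simp add: prod_eq_iff fst_sum snd_sum scalar_mult_eq_scaleR)
  then show ?thesis
    by (simp only: add scaleR sum real_scaleR_def d_t_def d_x_def)
qed

text \<open>
  At interior points the derivative of the locally vanishing \<open>f\<close> is zero; the two hyperboloids bounding
  the slab are reached by continuity, so uniqueness of one-sided derivatives is never used.
\<close>

lemma pderiv_in_eq_0:
  assumes "0 \<le> s\<^sub>0" "s\<^sub>0 < s\<^sub>1" and f: "f differentiable_on slab s\<^sub>0 s\<^sub>1"
    and g: "continuous_on (slab s\<^sub>0 s\<^sub>1) (pderiv_in (slab s\<^sub>0 s\<^sub>1) e f)"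
    and N: "open N" and f0: "\<forall>p \<in> N \<inter> slab s\<^sub>0 s\<^sub>1. f p = 0"
  shows "\<forall>p \<in> N \<inter> slab s\<^sub>0 s\<^sub>1. pderiv_in (slab s\<^sub>0 s\<^sub>1) e f p = 0"
proof
  let ?g = "pderiv_in (slab s\<^sub>0 s\<^sub>1) e f"
  have int: "?g p = 0" if p: "p \<in> N \<inter> open_slab s\<^sub>0 s\<^sub>1" for p
  proof -
    have "(f has_derivative (\<lambda>_. 0)) (at p)"
      by (rule has_derivative_transform_within_open[OF has_derivative_const, of "N \<inter> open_slab s\<^sub>0 s\<^sub>1" _ 0])
        (use p f0 N open_open_slab open_slab_subset[of s\<^sub>0 s\<^sub>1] in auto)
    then have "(\<lambda>v. pderiv_in (slab s\<^sub>0 s\<^sub>1) v f p) = (\<lambda>_. 0)"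
      using has_derivative_in_open_slab[OF f] p by (blast intro: has_derivative_unique)
    then show ?thesis by meson
  qed
  fix p assume p: "p \<in> N \<inter> slab s\<^sub>0 s\<^sub>1"
  define s x where "s = hyp_time p" and "x = snd p"
  have px: "hyp_point s x = p" and s: "s \<in> {s\<^sub>0..s\<^sub>1}" and pc: "p \<in> light_cone"
    using p hyp_point_hyp_time by (auto simp: s_def x_def slab_def)
  have "s \<in> closure {s\<^sub>0<..<s\<^sub>1}" using s assms(2) by simp
  then obtain \<sigma> where \<sigma>: "\<And>n. \<sigma> n \<in> {s\<^sub>0<..<s\<^sub>1}" "\<sigma> \<longlonglongrightarrow> s"
    unfolding closure_sequential by blast
  have lim: "(\<lambda>n. hyp_point (\<sigma> n) x) \<longlonglongrightarrow> p"
    unfolding px[symmetric] hyp_point_def by (intro tendsto_intros \<sigma>)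
  have "eventually (\<lambda>n. hyp_point (\<sigma> n) x \<in> N \<inter> light_cone) sequentially"
    using p pc by (intro topological_tendstoD[OF lim] open_Int N open_light_cone) auto
  then have ev: "eventually (\<lambda>n. hyp_point (\<sigma> n) x \<in> N \<inter> open_slab s\<^sub>0 s\<^sub>1) sequentially"
    by eventually_elim (use \<sigma>(1) assms(1) hyp_point_in_open_slab in auto)
  have "(\<lambda>n. ?g (hyp_point (\<sigma> n) x)) \<longlonglongrightarrow> ?g p"
    by (rule continuous_on_tendsto_compose[OF g lim])
      (use p ev open_slab_subset in \<open>auto elim!: eventually_mono\<close>)
  moreover have "(\<lambda>n. ?g (hyp_point (\<sigma> n) x)) \<longlonglongrightarrow> 0"
    by (rule tendsto_eventually, rule eventually_mono[OF ev int])
  ultimately show "?g p = 0" by (rule LIMSEQ_unique)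
qed

text \<open>A general curve with velocity (a, b) covers the coordinate curves in s and in x^i at
  once. Inside the cone this is the chain rule; elsewhere the lift vanishes identically near the
  given parameter.\<close>

lemma DERIV_hyp_lift:
  fixes \<sigma> :: "real \<Rightarrow> real" and y :: "real \<Rightarrow> real^3"
  assumes "0 \<le> s\<^sub>0" and f: "f differentiable_on slab s\<^sub>0 s\<^sub>1"
    and N: "open N" "cone_boundary \<subseteq> N" and f0: "\<forall>p \<in> N \<inter> slab s\<^sub>0 s\<^sub>1. f p = 0"
    and cont: "continuous_on UNIV \<sigma>" "continuous_on UNIV y" and \<sigma>: "\<sigma> z \<in> {s\<^sub>0<..<s\<^sub>1}"
    and der: "((\<lambda>h. hyp_point (\<sigma> h) (y h)) has_vector_derivative (a, b)) (at z)"
  shows "((\<lambda>h. hyp_lift f (\<sigma> h) (y h)) has_real_derivative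
    (a * hyp_lift (d_t (slab s\<^sub>0 s\<^sub>1) f) (\<sigma> z) (y z)
     + (\<Sum>i\<in>UNIV. b $ i * hyp_lift (d_x (slab s\<^sub>0 s\<^sub>1) i f) (\<sigma> z) (y z)))) (at z)"
proof (cases "hyp_point (\<sigma> z) (y z) \<in> light_cone")
  case True
  let ?\<gamma> = "\<lambda>h. hyp_point (\<sigma> h) (y h)" and ?D = "slab s\<^sub>0 s\<^sub>1"
  have p: "?\<gamma> z \<in> open_slab s\<^sub>0 s\<^sub>1"
    using hyp_point_in_open_slab assms(1) \<sigma> True by blast
  interpret bounded_linear "\<lambda>v. pderiv_in ?D v f (?\<gamma> z)"
    by (rule has_derivative_bounded_linear[OF has_derivative_in_open_slab[OF f p]])
  have "((\<lambda>h. f (?\<gamma> h)) has_derivative (\<lambda>h. pderiv_in ?D (h *\<^sub>R (a, b)) f (?\<gamma> z))) (at z)"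
    using der unfolding has_vector_derivative_def
    by (rule has_derivative_compose) (rule has_derivative_in_open_slab[OF f p])
  then have "((\<lambda>h. f (?\<gamma> h)) has_real_derivative pderiv_in ?D (a, b) f (?\<gamma> z)) (at z)"
    unfolding has_field_derivative_def by (simp only: scaleR) (simp add: mult_commute_abs)
  then have "((\<lambda>h. hyp_lift f (\<sigma> h) (y h)) has_real_derivative pderiv_in ?D (a, b) f (?\<gamma> z)) (at z)"
  proof (rule has_field_derivative_transform_within_open)
    show "open (?\<gamma> -` light_cone)"
      by (intro open_vimage open_light_cone continuous_intros cont)
  qed (use True in \<open>auto simp: hyp_lift_def\<close>)
  then show ?thesis
    using pderiv_in_eq_d_t_d_x[OF f p] True by (simp add: hyp_lift_def)
next
  case False
  obtain U where U: "open U" "- light_cone \<subseteq> U"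
    and U0: "\<And>s x. s \<in> {s\<^sub>0..s\<^sub>1} \<Longrightarrow> hyp_point s x \<in> U \<Longrightarrow> hyp_lift f s x = 0"
    using hyp_lift_eq_0_near_complement[OF N, of s\<^sub>0 s\<^sub>1] assms(1) f0 by metis
  have "((\<lambda>h. hyp_lift f (\<sigma> h) (y h)) has_real_derivative 0) (at z)"
  proof (rule has_field_derivative_transform_within_open[OF DERIV_const[of 0]])
    \<comment> \<open>\<open>U0\<close> speaks only of s in the range of the slab, hence the
      intersection with the preimage of the open interval.\<close>
    show "open ((\<lambda>h. hyp_point (\<sigma> h) (y h)) -` U \<inter> \<sigma> -` {s\<^sub>0<..<s\<^sub>1})"
      by (intro open_Int open_vimage U continuous_intros cont open_greaterThanLessThan)
  qed (use False U(2) \<sigma> U0 in auto)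
  then show ?thesis
    using False by (simp add: hyp_lift_def)
qed

text \<open>Restricting u to points reached from p in the directions e and e' reduces the claim to a
  function of two real variables.\<close>

lemma pderiv_in_commute:
  assumes u: "Ck_on 2 (slab s\<^sub>0 s\<^sub>1) u" and e: "e \<in> Basis" "e' \<in> Basis" and p: "p \<in> open_slab s\<^sub>0 s\<^sub>1"
  shows "pderiv_in (slab s\<^sub>0 s\<^sub>1) e (pderiv_in (slab s\<^sub>0 s\<^sub>1) e' u) p
    = pderiv_in (slab s\<^sub>0 s\<^sub>1) e' (pderiv_in (slab s\<^sub>0 s\<^sub>1) e u) p"
proof -
  let ?P = "pderiv_in (slab s\<^sub>0 s\<^sub>1)"
  have u1: "u differentiable_on slab s\<^sub>0 s\<^sub>1" "\<And>e. e \<in> Basis \<Longrightarrow> ?P e u differentiable_on slab s\<^sub>0 s\<^sub>1"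
    and u2: "\<And>e e'. e \<in> Basis \<Longrightarrow> e' \<in> Basis \<Longrightarrow> continuous_on (slab s\<^sub>0 s\<^sub>1) (?P e (?P e' u))"
    using u by (auto simp: numeral_2_eq_2)
  obtain r where r: "r > 0" "ball p r \<subseteq> open_slab s\<^sub>0 s\<^sub>1"
    using open_open_slab p by (meson openE)
  let ?q = "\<lambda>x y. p + x *\<^sub>R e + y *\<^sub>R e'"
  \<comment> \<open>Basis vectors have norm 1, so parameters below r / 2 keep the point in the ball
    of radius r.\<close>
  have q: "?q x y \<in> open_slab s\<^sub>0 s\<^sub>1" if "\<bar>x\<bar> < r / 2" "\<bar>y\<bar> < r / 2" for x y
  proof -
    have "norm (x *\<^sub>R e + y *\<^sub>R e') \<le> \<bar>x\<bar> + \<bar>y\<bar>"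
      using e by (intro order_trans[OF norm_triangle_ineq]) simp
    also have "\<dots> < r" using that by simp
    finally have "dist p (p + (x *\<^sub>R e + y *\<^sub>R e')) < r"
      using dist_add_cancel[of p 0 "x *\<^sub>R e + y *\<^sub>R e'"]
      by (simp only: add_0_right dist_0_norm)
    then have "dist p (?q x y) < r"
      by (simp only: add.assoc)
    then show ?thesis using r(2) by auto
  qed
  have line: "((\<lambda>h. f (a + h *\<^sub>R v)) has_real_derivative ?P v f (a + x *\<^sub>R v)) (at x)"
    if f: "f differentiable_on slab s\<^sub>0 s\<^sub>1" and ax: "a + x *\<^sub>R v \<in> open_slab s\<^sub>0 s\<^sub>1" for f a x v
  proof -
    interpret bounded_linear "\<lambda>w. ?P w f (a + x *\<^sub>R v)"
      by (rule has_derivative_bounded_linear[OF has_derivative_in_open_slab[OF f ax]])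
    have "((\<lambda>h. a + h *\<^sub>R v) has_derivative (\<lambda>h. h *\<^sub>R v)) (at x)"
      by (auto intro!: derivative_eq_intros)
    then have "((\<lambda>h. f (a + h *\<^sub>R v)) has_derivative (\<lambda>h. ?P (h *\<^sub>R v) f (a + x *\<^sub>R v))) (at x)"
      by (rule has_derivative_compose) (rule has_derivative_in_open_slab[OF f ax])
    then show ?thesis
      unfolding has_field_derivative_def by (simp only: scaleR) (simp add: mult_commute_abs)
  qed
  have lines: "((\<lambda>x. f (?q x y)) has_real_derivative ?P e f (?q x y)) (at x)"
      "((\<lambda>y. f (?q x y)) has_real_derivative ?P e' f (?q x y)) (at y)"
    if "f differentiable_on slab s\<^sub>0 s\<^sub>1" "\<bar>x\<bar> < r / 2" "\<bar>y\<bar> < r / 2" for f x y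
    using line[OF that(1), of "p + y *\<^sub>R e'" x e] line[OF that(1), of "p + x *\<^sub>R e" y e'] q[OF that(2,3)]
    by (simp_all add: algebra_simps)
  have cont: "isCont (\<lambda>(x, y). ?P v (?P w u) (?q x y)) (0, 0)" if "v \<in> Basis" "w \<in> Basis" for v w
  proof -
    have "isCont (?P v (?P w u)) p"
      using u2[OF that] p open_open_slab open_slab_subset
      by (meson continuous_on_interior interior_maximal subsetD)
    then have "isCont (?P v (?P w u)) (?q (fst (0, 0)) (snd (0, 0)))" by simp
    then show ?thesis
      unfolding case_prod_unfold
      by (rule isCont_o2[rotated]) (intro continuous_intros)
  qed
  have "?P e' (?P e u) (?q 0 0) = ?P e (?P e' u) (?q 0 0)"
    by (rule mixed_partial_derivatives_eq[where \<delta>="r / 2" and f="\<lambda>x y. u (?q x y)"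
          and ?f1.0="\<lambda>x y. ?P e u (?q x y)" and ?f2.0="\<lambda>x y. ?P e' u (?q x y)"])
      (use r e u1 lines cont in auto)
  then show ?thesis by simp
qed

section \<open>Hyperboloid integrals and coordinate derivatives\<close>

lemma hyp_integral_eq: "hyp_integral s f = (\<integral>x. hyp_lift f s x \<partial>lborel)"
  unfolding hyp_integral_def set_lebesgue_integral_def hyp_lift_def
  by (rule Bochner_Integration.integral_cong) (auto simp: indicator_def)

text \<open>This is 1/t on the hyperboloid. The derivatives of t in s and x^i are s/t and x^i/t, so
  treating 1/t as one quantity makes all later coefficients polynomial.\<close>

definition inv_time :: "real \<Rightarrow> real^3 \<Rightarrow> real" where
  "inv_time s x = inverse (sqrt (s\<^sup>2 + (norm x)\<^sup>2))"

lemma radicand_pos: "s > 0 \<Longrightarrow> s\<^sup>2 + (norm x)\<^sup>2 > 0" for s :: real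
  by (simp add: add_pos_nonneg)

text \<open>Free of roots and divisions, this is the relation between 1/t, s and x on which the
  polynomial proof of the wave equation rests.\<close>

lemma inv_time_power2: "s > 0 \<Longrightarrow> (inv_time s x)\<^sup>2 * (s\<^sup>2 + (\<Sum>i\<in>UNIV. (x $ i)\<^sup>2)) = 1"
  using radicand_pos[of s x]
  by (simp add: inv_time_def power_inverse norm_vec_def L2_set_def sum_nonneg)

lemma has_vector_derivative_hyp_point_s:
  assumes "s > 0"
  shows "((\<lambda>\<sigma>. hyp_point \<sigma> x) has_vector_derivative (s * inv_time s x, 0)) (at s)"
proof -
  have "((\<lambda>\<sigma>. sqrt (\<sigma>\<^sup>2 + (norm x)\<^sup>2)) has_real_derivative s * inv_time s x) (at s)"
    using radicand_pos[OF assms, of x] by (auto intro!: derivative_eq_intros simp: inv_time_def)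
  then show ?thesis
    unfolding hyp_point_def has_real_derivative_iff_has_vector_derivative
    by (intro has_vector_derivative_Pair has_vector_derivative_const)
qed

lemma DERIV_radicand_axis:
  "((\<lambda>h. s\<^sup>2 + (norm (x + h *\<^sub>R axis i 1))\<^sup>2) has_real_derivative 2 * x $ i) (at 0)" for x :: "real^'n" and s :: real
proof -
  have "s\<^sup>2 + (norm (x + h *\<^sub>R axis i 1))\<^sup>2 = s\<^sup>2 + (norm x)\<^sup>2 + 2 * h * x $ i + h\<^sup>2" for h
    unfolding power2_norm_eq_inner
    by (simp add: inner_add_left inner_add_right inner_axis inner_axis' power2_eq_square algebra_simps)
  then show ?thesis
    by (auto intro!: derivative_eq_intros)
qed

text \<open>Writing the derivative of the radicand as 2 d fits both coordinate directions, with d =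
  s and d = x^i.\<close>

lemma DERIV_sqrt_half:
  assumes "(g has_real_derivative 2 * d) (at z)" and "g z > 0"
  shows "((\<lambda>h. sqrt (g h)) has_real_derivative d * inverse (sqrt (g z))) (at z)"
    and "((\<lambda>h. inverse (sqrt (g h))) has_real_derivative - d * (inverse (sqrt (g z)))^3) (at z)"
  using assms by (auto intro!: derivative_eq_intros simp: power3_eq_cube field_simps)

lemma has_vector_derivative_hyp_point_x:
  assumes "s > 0"
  shows "((\<lambda>h. hyp_point s (x + h *\<^sub>R axis i 1)) has_vector_derivative (x $ i * inv_time s x, axis i 1)) (at 0)"
proof -
  have "((\<lambda>h. sqrt (s\<^sup>2 + (norm (x + h *\<^sub>R axis i 1))\<^sup>2)) has_real_derivative x $ i * inv_time s x) (at 0)"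
    using DERIV_sqrt_half(1)[OF DERIV_radicand_axis, of s x i] radicand_pos[OF assms, of x]
    by (simp add: inv_time_def)
  moreover have "((\<lambda>h. x + h *\<^sub>R axis i 1) has_vector_derivative axis i 1) (at 0)"
    by (auto intro!: derivative_eq_intros)
  ultimately show ?thesis
    unfolding hyp_point_def has_real_derivative_iff_has_vector_derivative
    by (intro has_vector_derivative_Pair)
qed

lemma DERIV_inv_time_s:
  assumes "s > 0"
  shows "((\<lambda>\<sigma>. inv_time \<sigma> x) has_real_derivative - s * (inv_time s x)^3) (at s)"
  unfolding inv_time_def
  by (rule DERIV_sqrt_half(2)) (use radicand_pos[OF assms] in \<open>auto intro!: derivative_eq_intros\<close>)

lemma DERIV_inv_time_x:
  assumes "s > 0"
  shows "((\<lambda>h. inv_time s (x + h *\<^sub>R axis i 1)) has_real_derivative - x $ i * (inv_time s x)^3) (at 0)"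
  using DERIV_sqrt_half(2)[OF DERIV_radicand_axis, of s x i] radicand_pos[OF assms, of x]
  by (simp add: inv_time_def)

lemma continuous_on_inv_time:
  assumes "0 < s\<^sub>0"
  shows "continuous_on ({s\<^sub>0..s\<^sub>1} \<times> UNIV) (\<lambda>z. inv_time (fst z) (snd z))"
proof -
  have "sqrt ((fst z)\<^sup>2 + (norm (snd z))\<^sup>2) \<noteq> 0" if "z \<in> {s\<^sub>0..s\<^sub>1} \<times> UNIV" for z :: "real \<times> (real^3)"
    using that assms radicand_pos[of "fst z" "snd z"] by auto
  then show ?thesis
    unfolding inv_time_def by (intro continuous_intros) blast
qed

text \<open>The coefficient is s/t, so differentiation in s at fixed x is the frame derivative
  \<open>bar_d_s\<close>.\<close>

lemma DERIV_hyp_lift_s: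
  assumes "0 \<le> s\<^sub>0" and f: "f differentiable_on slab s\<^sub>0 s\<^sub>1"
    and N: "open N" "cone_boundary \<subseteq> N" and f0: "\<forall>p \<in> N \<inter> slab s\<^sub>0 s\<^sub>1. f p = 0"
    and s: "s \<in> {s\<^sub>0<..<s\<^sub>1}"
  shows "((\<lambda>\<sigma>. hyp_lift f \<sigma> x) has_real_derivative
    s * inv_time s x * hyp_lift (d_t (slab s\<^sub>0 s\<^sub>1) f) s x) (at s)"
  using DERIV_hyp_lift[OF assms(1-5), of "\<lambda>\<sigma>. \<sigma>" "\<lambda>_. x" s, OF _ _ s has_vector_derivative_hyp_point_s]
    assms(1) s by simp

lemma DERIV_hyp_lift_x:
  assumes "0 \<le> s\<^sub>0" and f: "f differentiable_on slab s\<^sub>0 s\<^sub>1"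
    and N: "open N" "cone_boundary \<subseteq> N" and f0: "\<forall>p \<in> N \<inter> slab s\<^sub>0 s\<^sub>1. f p = 0"
    and s: "s \<in> {s\<^sub>0<..<s\<^sub>1}"
  shows "((\<lambda>h. hyp_lift f s (x + h *\<^sub>R axis i 1)) has_real_derivative
    (x $ i * inv_time s x * hyp_lift (d_t (slab s\<^sub>0 s\<^sub>1) f) s x + hyp_lift (d_x (slab s\<^sub>0 s\<^sub>1) i f) s x)) (at 0)"
proof -
  have "continuous_on UNIV (\<lambda>h. x + h *\<^sub>R axis i 1)"
    by (intro continuous_intros)
  then show ?thesis
    using DERIV_hyp_lift[OF assms(1-5), of "\<lambda>_. s" "\<lambda>h. x + h *\<^sub>R axis i 1" 0, OF _ _ s has_vector_derivative_hyp_point_x]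
      assms(1) s
    by (simp add: axis_def if_distrib[of "\<lambda>c. c * _"] cong: if_cong)
qed

section \<open>The conformal energy estimate on the slab\<close>

theorem proposition2p1:
  fixes s\<^sub>0 s\<^sub>1 s :: real and u :: "spacetime \<Rightarrow> real"
  assumes "1 < s\<^sub>0" and "s\<^sub>0 < s\<^sub>1"
    and "Ck_on 2 (slab s\<^sub>0 s\<^sub>1) u"
    and "vanishes_near_cone (slab s\<^sub>0 s\<^sub>1) u"
    and "s \<in> {s\<^sub>0..s\<^sub>1}"
  shows "sqrt (E_con (slab s\<^sub>0 s\<^sub>1) s u) \<le> sqrt (E_con (slab s\<^sub>0 s\<^sub>1) s\<^sub>0 u)
           + 2 * (LBINT \<tau>:{s\<^sub>0..s}. \<tau> * hyp_L2_norm \<tau> (wave_op (slab s\<^sub>0 s\<^sub>1) u))"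
proof -
  have s0: "0 < s\<^sub>0" "0 \<le> s\<^sub>0" using assms(1) by auto
  let ?D = "slab s\<^sub>0 s\<^sub>1"
  let ?P = "pderiv_in ?D"
  let ?I = "{s\<^sub>0<..<s\<^sub>1}" and ?J = "{s\<^sub>0..s\<^sub>1}"
  obtain N where N: "open N" "cone_boundary \<subseteq> N" and u0: "\<forall>p \<in> N \<inter> ?D. u p = 0"
    using assms(4) unfolding vanishes_near_cone_def by blast
  have u1: "u differentiable_on ?D" "\<And>e. e \<in> Basis \<Longrightarrow> ?P e u differentiable_on ?D"
    and u2: "\<And>e e'. e \<in> Basis \<Longrightarrow> e' \<in> Basis \<Longrightarrow> continuous_on ?D (?P e (?P e' u))"
    using assms(3) by (auto simp: numeral_2_eq_2)
  \<comment> \<open>First and second derivatives vanish on the same neighbourhood \<open>N\<close>,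
    so they too extend continuously by zero.\<close>
  have Pu0: "\<forall>p \<in> N \<inter> ?D. ?P e u p = 0" if "e \<in> Basis" for e
    by (rule pderiv_in_eq_0[OF s0(2) assms(2) u1(1) _ N(1) u0])
      (rule differentiable_imp_continuous_on[OF u1(2)[OF that]])
  have PPu0: "\<forall>p \<in> N \<inter> ?D. ?P e (?P e' u) p = 0" if "e \<in> Basis" "e' \<in> Basis" for e e'
    by (rule pderiv_in_eq_0[OF s0(2) assms(2) u1(2)[OF that(2)] u2[OF that] N(1) Pu0[OF that(2)]])
  have basis [simp]: "(1, 0) \<in> (Basis :: spacetime set)" "(0, axis i 1) \<in> (Basis :: spacetime set)" for i
    by (auto simp: Basis_prod_def axis_in_Basis_iff)

  \<comment> \<open>Lifts vanish for |x| > s^2 and s is at most \<open>s\<^sub>1\<close>, so one box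
    supports all of them.\<close>
  obtain c :: "real^3" where c: "cball 0 (s\<^sub>1\<^sup>2) \<subseteq> cbox (-c) c"
    using bounded_subset_cbox_symmetric[OF bounded_cball] by blast
  let ?C = "cbox (-c) c"
  define V T where "V = hyp_lift u" and "T = hyp_lift (d_t ?D u)"
  define X where "X = (\<lambda>i. hyp_lift (d_x ?D i u))"
  define Tt where "Tt = hyp_lift (d_t ?D (d_t ?D u))"
  define Tx where "Tx = (\<lambda>i. hyp_lift (d_x ?D i (d_t ?D u)))"
  define Xx where "Xx = (\<lambda>i j. hyp_lift (d_x ?D i (d_x ?D j u)))"
  note lift = cont_supp_hyp_lift[OF s0(2) _ N _ c]
  have supp: "cont_supp ?J ?C V" "cont_supp ?J ?C T" "cont_supp ?J ?C (X i)"
    "cont_supp ?J ?C Tt" "cont_supp ?J ?C (Tx i)" "cont_supp ?J ?C (Xx i j)" for i j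
    unfolding V_def T_def X_def Tt_def Tx_def Xx_def d_t_def d_x_def
    by (intro lift differentiable_imp_continuous_on u1 u2 u0 Pu0 PPu0 basis)+
  note lift_s = DERIV_hyp_lift_s[OF s0(2) _ N]
  note lift_x = DERIV_hyp_lift_x[OF s0(2) _ N]
  have diff: "d_t ?D u differentiable_on ?D" "d_x ?D i u differentiable_on ?D" for i
    unfolding d_t_def d_x_def by (intro u1 basis)+
  have van: "\<forall>p \<in> N \<inter> ?D. d_t ?D u p = 0" "\<forall>p \<in> N \<inter> ?D. d_x ?D i u p = 0" for i
    unfolding d_t_def d_x_def by (intro Pu0 basis)+
  \<comment> \<open>Off the cone both lifts are zero; in the cone, s strictly between the bounds
    puts the point into the open slab, where mixed derivatives commute.\<close>
  have commute: "hyp_lift (d_t ?D (d_x ?D i u)) \<sigma> x = Tx i \<sigma> x" "Xx i j \<sigma> x = Xx j i \<sigma> x"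
    if "\<sigma> \<in> ?I" for i j \<sigma> x
    using pderiv_in_commute[OF assms(3) basis(1) basis(2)] pderiv_in_commute[OF assms(3) basis(2) basis(2)]
      hyp_point_in_open_slab[OF s0(2) that]
    by (auto simp: hyp_lift_def Tx_def Xx_def d_t_def d_x_def)
  have ds: "((\<lambda>\<sigma>. V \<sigma> x) has_real_derivative \<sigma> * inv_time \<sigma> x * T \<sigma> x) (at \<sigma>)"
    "((\<lambda>\<sigma>. T \<sigma> x) has_real_derivative \<sigma> * inv_time \<sigma> x * Tt \<sigma> x) (at \<sigma>)"
    "((\<lambda>\<sigma>. X i \<sigma> x) has_real_derivative \<sigma> * inv_time \<sigma> x * Tx i \<sigma> x) (at \<sigma>)"
    if "\<sigma> \<in> ?I" for \<sigma> x i
    using lift_s[OF u1(1) u0 that] lift_s[OF diff(1) van(1) that] lift_s[OF diff(2) van(2) that] commute(1)[OF that]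
    by (simp_all add: V_def T_def X_def Tt_def)
  have dx: "((\<lambda>h. V \<sigma> (x + h *\<^sub>R axis i 1)) has_real_derivative x $ i * inv_time \<sigma> x * T \<sigma> x + X i \<sigma> x) (at 0)"
    "((\<lambda>h. T \<sigma> (x + h *\<^sub>R axis i 1)) has_real_derivative x $ i * inv_time \<sigma> x * Tt \<sigma> x + Tx i \<sigma> x) (at 0)"
    "((\<lambda>h. X j \<sigma> (x + h *\<^sub>R axis i 1)) has_real_derivative x $ i * inv_time \<sigma> x * Tx j \<sigma> x + Xx i j \<sigma> x) (at 0)"
    if "\<sigma> \<in> ?I" for \<sigma> x i j
    using lift_x[OF u1(1) u0 that] lift_x[OF diff(1) van(1) that] lift_x[OF diff(2) van(2) that] commute(1)[OF that]
    by (simp_all add: V_def T_def X_def Tt_def Tx_def Xx_def)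

  define R where "R = inv_time"
  have R2: "(R \<sigma> x)\<^sup>2 * (\<sigma>\<^sup>2 + (\<Sum>i\<in>UNIV. (x $ i)\<^sup>2)) = 1" if "\<sigma> \<in> ?J" for \<sigma> x
    using inv_time_power2 that s0 by (simp add: R_def)
  have cR: "continuous_on (?J \<times> UNIV) (\<lambda>z. R (fst z) (snd z))"
    unfolding R_def by (rule continuous_on_inv_time[OF s0(1)])
  have dRs: "((\<lambda>\<sigma>. R \<sigma> x) has_real_derivative - \<sigma> * (R \<sigma> x)^3) (at \<sigma>)"
    and dRx: "((\<lambda>h. R \<sigma> (x + h *\<^sub>R axis i 1)) has_real_derivative - x $ i * (R \<sigma> x)^3) (at 0)"
    if "\<sigma> \<in> ?I" for \<sigma> x i
    using that s0 DERIV_inv_time_s DERIV_inv_time_x by (auto simp: R_def)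
  note ds = ds[folded R_def] and dx = dx[folded R_def]

  \<comment> \<open>These come from \<open>ds\<close> and \<open>dx\<close> by the product rule,
    with derivatives - s R^3 and - x^i R^3 of \<open>R\<close>. As explicit formulas they are
    continuous on the closed interval, while they are shown to be derivatives for s strictly
    inside.\<close>
  define Vs where "Vs = (\<lambda>s x. s * R s x * T s x)"
  define Vx where "Vx = (\<lambda>i s x. x $ i * R s x * T s x + X i s x)"
  define Vss where "Vss = (\<lambda>s x. (R s x - s\<^sup>2 * R s x ^ 3) * T s x + s\<^sup>2 * (R s x)\<^sup>2 * Tt s x)"
  define Vsx where "Vsx = (\<lambda>i s x. - (s * x $ i * R s x ^ 3) * T s x
    + (s * x $ i * (R s x)\<^sup>2) * Tt s x + s * R s x * Tx i s x)"
  define Vxx where "Vxx = (\<lambda>i j s x. ((if i = j then R s x else 0) - x $ i * x $ j * R s x ^ 3) * T s x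
    + (x $ i * x $ j * (R s x)\<^sup>2) * Tt s x + (x $ j * R s x) * Tx i s x + (x $ i * R s x) * Tx j s x + Xx i j s x)"
  define B where "B = (\<lambda>s x. Tt s x - (\<Sum>i\<in>UNIV. Xx i i s x))"
  define W where "W = (\<lambda>s x. s * Vs s x + 2 * (\<Sum>i\<in>UNIV. x $ i * Vx i s x) + 2 * V s x)"
  define E where "E = (\<lambda>s. \<integral>x. (\<Sum>i\<in>UNIV. (s * Vx i s x)\<^sup>2) + (W s x)\<^sup>2 \<partial>lborel)"
  define n where "n = (\<lambda>s. s * sqrt (\<integral>x. (B s x)\<^sup>2 \<partial>lborel))"
  note cs = cont_supp_add cont_supp_diff cont_supp_sum cont_supp_mult_left supp
  \<comment> \<open>This handles the Kronecker delta in \<open>Vxx\<close>, whose condition is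
    constant in s and x.\<close>
  have cR_if: "continuous_on (?J \<times> UNIV) (\<lambda>z. if P then R (fst z) (snd z) else 0)" for P
    by (cases P) (use cR in auto)
  have supp': "cont_supp ?J ?C Vs" "cont_supp ?J ?C (Vx i)" "cont_supp ?J ?C Vss" "cont_supp ?J ?C (Vsx i)"
    "cont_supp ?J ?C (Vxx i j)" "cont_supp ?J ?C B" for i j
    unfolding Vs_def Vx_def Vss_def Vsx_def Vxx_def B_def
    by ((intro cs; unfold case_prod_unfold; intro continuous_intros cR cR_if)+)
  have W: "cont_supp ?J ?C W"
    unfolding W_def
    by (intro cs supp'; unfold case_prod_unfold; intro continuous_intros)
  have e: "cont_supp ?J ?C (\<lambda>s x. (\<Sum>i\<in>UNIV. (s * Vx i s x)\<^sup>2) + (W s x)\<^sup>2)"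
    by (intro cont_supp_add cont_supp_sum cont_supp_power2 cont_supp_mult_left W supp';
        unfold case_prod_unfold; intro continuous_intros)

  have dE: "(E has_real_derivative 2 * \<sigma> * (\<integral>x. W \<sigma> x * B \<sigma> x \<partial>lborel)) (at \<sigma>)" if \<sigma>: "\<sigma> \<in> ?I" for \<sigma>
    unfolding E_def W_def
  proof (rule conformal_energy_derivative[where Vss=Vss and Vsx=Vsx and Vxx=Vxx and \<alpha>=s\<^sub>0 and \<beta>=s\<^sub>1 and lo="-c" and hi=c])
    have IJ: "?I \<subseteq> ?J" by auto
    show "cont_supp ?I ?C V" "cont_supp ?I ?C Vs" "cont_supp ?I ?C (Vx i)" "cont_supp ?I ?C Vss"
      "cont_supp ?I ?C (Vsx i)" "cont_supp ?I ?C (Vxx i j)" "cont_supp ?I ?C B" for i j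
      by (rule cont_supp_subset[OF _ IJ], rule supp supp')+
    fix \<sigma> i j and x :: "real^3" assume \<sigma>: "\<sigma> \<in> ?I"
    note ds = ds[OF \<sigma>] dRs[OF \<sigma>] and dx = dx[OF \<sigma>] dRx[OF \<sigma>]
    have nth: "((\<lambda>h. (x + h *\<^sub>R axis i 1) $ j) has_real_derivative (if i = j then 1 else 0)) (at 0)"
      by (auto intro!: derivative_eq_intros simp: axis_def)
    show "((\<lambda>\<sigma>. V \<sigma> x) has_real_derivative Vs \<sigma> x) (at \<sigma>)"
      unfolding Vs_def by (rule ds)
    show "((\<lambda>\<sigma>. Vs \<sigma> x) has_real_derivative Vss \<sigma> x) (at \<sigma>)"
      unfolding Vs_def Vss_def
      by (rule derivative_eq_intros ds refl)+ (simp add: power2_eq_square power3_eq_cube algebra_simps)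
    show "((\<lambda>\<sigma>. Vx i \<sigma> x) has_real_derivative Vsx i \<sigma> x) (at \<sigma>)"
      unfolding Vx_def Vsx_def
      by (rule derivative_eq_intros ds refl)+ (simp add: power2_eq_square power3_eq_cube algebra_simps)
    show "((\<lambda>h. V \<sigma> (x + h *\<^sub>R axis i 1)) has_real_derivative Vx i \<sigma> x) (at 0)"
      unfolding Vx_def by (rule dx)
    show "((\<lambda>h. Vs \<sigma> (x + h *\<^sub>R axis i 1)) has_real_derivative Vsx i \<sigma> x) (at 0)"
      unfolding Vs_def Vsx_def
      by (rule derivative_eq_intros dx refl)+ (simp add: power2_eq_square power3_eq_cube algebra_simps)
    show "((\<lambda>h. Vx j \<sigma> (x + h *\<^sub>R axis i 1)) has_real_derivative Vxx i j \<sigma> x) (at 0)"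
      unfolding Vx_def Vxx_def
      by (rule derivative_eq_intros nth dx refl)+ (simp add: power2_eq_square power3_eq_cube algebra_simps)
    show "Vxx i j \<sigma> x = Vxx j i \<sigma> x"
      using commute(2)[OF \<sigma>] by (simp add: Vxx_def algebra_simps)
    have R2: "(R \<sigma> x)\<^sup>2 * (\<sigma>\<^sup>2 + ((x $ 1)\<^sup>2 + (x $ 2)\<^sup>2 + (x $ 3)\<^sup>2)) = 1"
      using R2[of \<sigma> x] \<sigma> by (simp add: sum_3)
    \<comment> \<open>The \<open>Tx\<close> terms cancel outright, while \<open>R2\<close> reduces
      the coefficients of \<open>T\<close> and \<open>Tt\<close> to 0 and \<sigma>. The rule
      \<open>refl[THEN eqTrueI]\<close> evaluates the Kronecker delta on the diagonal.\<close>
    show "\<sigma> * B \<sigma> x = \<sigma> * Vss \<sigma> x + 2 * (\<Sum>i\<in>UNIV. x $ i * Vsx i \<sigma> x) + 3 * Vs \<sigma> x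
      - \<sigma> * (\<Sum>i\<in>UNIV. Vxx i i \<sigma> x)"
      unfolding Vs_def Vss_def Vsx_def Vxx_def B_def sum_3 if_True refl[THEN eqTrueI]
      using R2 by algebra
  qed (use \<sigma> in auto)

  have cn: "continuous_on ?J n"
    unfolding n_def
    by (intro continuous_intros continuous_on_integral_cont_supp cont_supp_power2) (rule supp')
  have "sqrt (E s) \<le> sqrt (E s\<^sub>0) + integral {s\<^sub>0..s} n"
  proof (rule sqrt_le_of_derivative_le[where E'="\<lambda>\<sigma>. 2 * \<sigma> * (\<integral>x. W \<sigma> x * B \<sigma> x \<partial>lborel)"])
    show "s\<^sub>0 \<le> s" using assms(5) by simp
    have sub: "{s\<^sub>0..s} \<subseteq> ?J" using assms(5) by simp
    show "continuous_on {s\<^sub>0..s} E"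
      unfolding E_def by (rule continuous_on_subset[OF continuous_on_integral_cont_supp[OF e] sub])
    show "continuous_on {s\<^sub>0..s} n"
      by (rule continuous_on_subset[OF cn sub])
    show "E \<sigma> \<ge> 0" for \<sigma>
      unfolding E_def by (intro integral_nonneg_AE) (simp add: sum_nonneg)
    show "n \<sigma> \<ge> 0" if "\<sigma> \<in> {s\<^sub>0..s}" for \<sigma>
      using that s0 by (auto simp: n_def)
    fix \<sigma> assume \<sigma>: "s\<^sub>0 < \<sigma>" "\<sigma> < s"
    then have \<sigma>': "\<sigma> \<in> ?I" "\<sigma> \<in> ?J" using assms(5) by auto
    show "(E has_real_derivative 2 * \<sigma> * (\<integral>x. W \<sigma> x * B \<sigma> x \<partial>lborel)) (at \<sigma>)"
      by (rule dE[OF \<sigma>'(1)])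
    note int = cont_supp_integral(1)[where a="-c" and b=c, OF _ \<sigma>'(2)]
    have "(\<integral>x. W \<sigma> x * B \<sigma> x \<partial>lborel)
        \<le> sqrt (\<integral>x. (W \<sigma> x)\<^sup>2 \<partial>lborel) * sqrt (\<integral>x. (B \<sigma> x)\<^sup>2 \<partial>lborel)"
      by (intro integral_mult_le_sqrt int[OF cont_supp_power2] int[OF cont_supp_mult] W supp')
    \<comment> \<open>The square of \<open>W\<close> is one of the nonnegative summands of the
      energy density.\<close>
    also have "\<dots> \<le> sqrt (E \<sigma>) * sqrt (\<integral>x. (B \<sigma> x)\<^sup>2 \<partial>lborel)"
      unfolding E_def
      by (intro mult_right_mono real_sqrt_le_mono integral_mono int[OF cont_supp_power2[OF W]] int[OF e])
        (auto simp: sum_nonneg)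
    finally show "2 * \<sigma> * (\<integral>x. W \<sigma> x * B \<sigma> x \<partial>lborel) \<le> 2 * sqrt (E \<sigma>) * n \<sigma>"
      using \<sigma> s0 by (simp add: n_def mult.assoc mult_left_mono mult.left_commute[of _ \<sigma>])
  qed
  also have "integral {s\<^sub>0..s} n = (LBINT \<tau>:{s\<^sub>0..s}. n \<tau>)"
    by (rule set_borel_integral_eq_integral(2)[symmetric], rule borel_integrable_atLeastAtMost')
      (use assms(5) in \<open>auto intro: continuous_on_subset[OF cn]\<close>)
  finally have main: "sqrt (E s) \<le> sqrt (E s\<^sub>0) + (LBINT \<tau>:{s\<^sub>0..s}. n \<tau>)" .
  \<comment> \<open>Nonnegativity lets the constant 1 in \<open>main\<close> be weakened to the
    stated 2.\<close>
  have nonneg: "0 \<le> (LBINT \<tau>:{s\<^sub>0..s}. n \<tau>)"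
    using s0 unfolding set_lebesgue_integral_def
    by (intro integral_nonneg_AE) (auto simp: n_def indicator_def)

  have proj: "fst (hyp_point \<sigma> x) = sqrt (\<sigma>\<^sup>2 + (norm x)\<^sup>2)" "snd (hyp_point \<sigma> x) = x" for \<sigma> x
    by (auto simp: hyp_point_def)
  \<comment> \<open>Off the cone both integrands are zero. Inside, \<open>hyp_time\<close> equals
    \<sigma>, so the frame derivatives are \<open>Vs\<close> and \<open>Vx\<close>, and Ku + 2u is
    \<open>W\<close>.\<close>
  have E_eq: "E_con ?D \<sigma> u = E \<sigma>" if "\<sigma> \<in> ?J" for \<sigma>
    unfolding E_con_def hyp_integral_eq E_def
    by (rule Bochner_Integration.integral_cong)
      (use that s0 in \<open>auto simp: hyp_lift_def W_def V_def Vs_def Vx_def T_def X_def R_def inv_time_def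
        K_op_def bar_d_s_def bar_d_x_def proj hyp_time_hyp_point divide_inverse\<close>)
  have n_eq: "\<sigma> * hyp_L2_norm \<sigma> (wave_op ?D u) = n \<sigma>" for \<sigma>
    unfolding n_def hyp_L2_norm_def hyp_integral_eq
    by (intro arg_cong[where f="\<lambda>r. \<sigma> * sqrt r"] Bochner_Integration.integral_cong refl)
      (simp add: hyp_lift_def B_def Tt_def Xx_def wave_op_def)
  show ?thesis
    using main nonneg assms(2,5) by (simp add: E_eq n_eq)
qed

end
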